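(* Let $n\ge1$, let $F\colon M\to N$ be a smooth map of manifolds (no further hypothesis on $M$, $N$ or $F$), and let $\varpi\in\Omega^{n+1}(F)$ be $d_F$-closed. Then $$L(\varpi):=\{k\in\mathbb Z : k\varpi \text{ is relatively integral}\}$$ is a subgroup of $\mathbb Z$; consequently there is a unique integer $k_0=k_0(\varpi)\ge0$ with $L(\varpi)=k_0\mathbb Z$.
   Context: For a smooth map $F\colon M\to N$: $\Omega^k(F)=\Omega^k(N)\oplus\Omega^{k-1}(M)$ with $d_F(\alpha,\beta)=(d\alpha,\,F^*\alpha-d\beta)$. $C_k(P)$ denotes smooth singular $k$-chains on $P$ with $\mathbb Z$ coefficients; $C_k(F)=C_k(N)\oplus C_{k-1}(M)$; $Z_k(F)$ is the group of relative cycles, i.e. pairs $(S,T)\in C_k(F)$ with $\partial S=F_*T$ and $\partial T=0$. The pairing is $\langle(\alpha,\beta),(S,T)\rangle=\int_S\alpha-\int_T\beta$. For $d_F$-closed $\varpi\in\Omega^{n+1}(F)$ the relative period group is $P_\varpi=\{\langle\varpi,c\rangle : c\in Z_{n+1}(F)\}\subseteq\mathbb R$, and $\varpi$ is relatively integral if $P_\varpi\subseteq\mathbb Z$. $L(\varpi)$ is called the level group and $k_0(\varpi)$ the prequantization level. *)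

theory Defs
  imports "HOL-Analysis.Analysis" "HOL-Homology.Homology"
begin

section \<open>Smooth functions on open subsets of Euclidean space\<close>

text \<open>
  Dimension is a natural number, so that dimension 0 is covered and all dimensions live in one type:
  following \<^const>\<open>Euclidean_space\<close>, a point of m-dimensional space is a function
  \<^typ>\<open>nat \<Rightarrow> real\<close> vanishing from index m on.
\<close>

definition partial_deriv :: "nat \<Rightarrow> ((nat \<Rightarrow> real) \<Rightarrow> real) \<Rightarrow> (nat \<Rightarrow> real) \<Rightarrow> real" where
  "partial_deriv i f x = deriv (\<lambda>s. f (x(i := s))) (x i)"

text \<open>Only meaningful for sets \<open>U\<close> that are open in \<open>Euclidean_space m\<close>.\<close>

definition C_infinity_on ::
    "nat \<Rightarrow> (nat \<Rightarrow> real) set \<Rightarrow> ((nat \<Rightarrow> real) \<Rightarrow> real) \<Rightarrow> bool" where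
  "C_infinity_on m U f \<longleftrightarrow>
     (\<forall>is \<in> lists {..<m}.
        continuous_map (subtopology (Euclidean_space m) U) euclideanreal (foldr partial_deriv is f) \<and>
        (\<forall>i<m. \<forall>x\<in>U. (\<lambda>s. foldr partial_deriv is f (x(i := s))) field_differentiable at (x i)))"


section \<open>Smooth manifolds and smooth maps\<close>

text \<open>
  A chart is a pair of a domain and a coordinate map. The atlas need not be maximal; every notion
  below is the same for an atlas and for the maximal atlas it generates. Values of functions outside
  the carrier \<open>topspace (mtop M)\<close> never matter.
\<close>

type_synonym 'a chart = "'a set \<times> ('a \<Rightarrow> nat \<Rightarrow> real)"

record 'a mfd =
  mtop :: "'a topology"
  mdim :: nat
  atlas :: "'a chart set"

abbreviation chart_inv :: "'a chart \<Rightarrow> (nat \<Rightarrow> real) \<Rightarrow> 'a" where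
  "chart_inv c \<equiv> inv_into (fst c) (snd c)"

definition smooth_manifold :: "'a mfd \<Rightarrow> bool" where
  "smooth_manifold M \<longleftrightarrow>
     Hausdorff_space (mtop M) \<and> second_countable (mtop M) \<and>
     (\<Union>c\<in>atlas M. fst c) = topspace (mtop M) \<and>
     (\<forall>(U, \<phi>) \<in> atlas M.
        openin (mtop M) U \<and> openin (Euclidean_space (mdim M)) (\<phi> ` U) \<and>
        homeomorphic_map (subtopology (mtop M) U)
          (subtopology (Euclidean_space (mdim M)) (\<phi> ` U)) \<phi>) \<and>
     (\<forall>(U, \<phi>) \<in> atlas M. \<forall>(V, \<psi>) \<in> atlas M. \<forall>j < mdim M.
        C_infinity_on (mdim M) (\<phi> ` (U \<inter> V)) (\<lambda>x. \<psi> (inv_into U \<phi> x) j))"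

definition smooth_map :: "'a mfd \<Rightarrow> 'b mfd \<Rightarrow> ('a \<Rightarrow> 'b) \<Rightarrow> bool" where
  "smooth_map M N F \<longleftrightarrow>
     continuous_map (mtop M) (mtop N) F \<and>
     (\<forall>(U, \<phi>) \<in> atlas M. \<forall>(V, \<psi>) \<in> atlas N. \<forall>j < mdim N.
        C_infinity_on (mdim M) (\<phi> ` {p \<in> U. F p \<in> V}) (\<lambda>x. \<psi> (F (inv_into U \<phi> x)) j))"

definition euclid_mfd :: "nat \<Rightarrow> (nat \<Rightarrow> real) set \<Rightarrow> (nat \<Rightarrow> real) mfd" where
  "euclid_mfd m W =
     \<lparr>mtop = subtopology (Euclidean_space m) W, mdim = m, atlas = {(W, id)}\<rparr>"


section \<open>Tangent vectors\<close>

definition smooth_near :: "'a mfd \<Rightarrow> 'a \<Rightarrow> ('a \<Rightarrow> real) \<Rightarrow> bool" where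
  "smooth_near M p f \<longleftrightarrow>
     (\<exists>W. openin (mtop M) W \<and> p \<in> W \<and>
        (\<forall>(U, \<phi>) \<in> atlas M. C_infinity_on (mdim M) (\<phi> ` (U \<inter> W)) (f \<circ> inv_into U \<phi>)))"

text \<open>
  The tangent space at p consists of the derivations at p of the algebra of germs of smooth
  functions. A derivation takes the value 0 on functions that are not smooth near p, so that it is
  determined by its values on germs.
\<close>

type_synonym 'a tvec = "('a \<Rightarrow> real) \<Rightarrow> real"

definition tangent_space :: "'a mfd \<Rightarrow> 'a \<Rightarrow> 'a tvec set" where
  "tangent_space M p =
     {v. (\<forall>f. \<not> smooth_near M p f \<longrightarrow> v f = 0) \<and>
         (\<forall>f g W. smooth_near M p f \<and> smooth_near M p g \<and> openin (mtop M) W \<and> p \<in> W \<and>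
            (\<forall>q\<in>W. f q = g q) \<longrightarrow> v f = v g) \<and>
         (\<forall>f g a b. smooth_near M p f \<and> smooth_near M p g \<longrightarrow>
            v (\<lambda>q. a * f q + b * g q) = a * v f + b * v g) \<and>
         (\<forall>f g. smooth_near M p f \<and> smooth_near M p g \<longrightarrow>
            v (\<lambda>q. f q * g q) = f p * v g + g p * v f)}"

text \<open>The i-th coordinate vector of the chart \<open>c\<close> at \<open>p\<close>.\<close>

definition coord_vec :: "'a mfd \<Rightarrow> 'a chart \<Rightarrow> nat \<Rightarrow> 'a \<Rightarrow> 'a tvec" where
  "coord_vec M c i p f =
     (if smooth_near M p f then partial_deriv i (f \<circ> chart_inv c) (snd c p) else 0)"

definition pushforward ::
    "'a mfd \<Rightarrow> 'b mfd \<Rightarrow> ('a \<Rightarrow> 'b) \<Rightarrow> 'a \<Rightarrow> 'a tvec \<Rightarrow> 'b tvec" where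
  "pushforward M N F p v g = (if smooth_near N (F p) g then v (g \<circ> F) else 0)"


section \<open>Differential forms\<close>

text \<open>
  A k-form takes a point and a list of k tangent vectors at that point. It is 0 on all other
  arguments, so that equality of forms is equality of functions.
\<close>

type_synonym 'a dform = "'a \<Rightarrow> 'a tvec list \<Rightarrow> real"

definition tuples :: "'a mfd \<Rightarrow> nat \<Rightarrow> 'a \<Rightarrow> 'a tvec list set" where
  "tuples M k p = {vs \<in> lists (tangent_space M p). length vs = k \<and> p \<in> topspace (mtop M)}"

definition diff_forms :: "'a mfd \<Rightarrow> nat \<Rightarrow> 'a dform set" where
  "diff_forms M k =
     {\<alpha>. (\<forall>p vs. vs \<notin> tuples M k p \<longrightarrow> \<alpha> p vs = 0) \<and>
         (\<forall>p. \<forall>vs \<in> tuples M k p. \<forall>i<k. \<forall>v \<in> tangent_space M p. \<forall>w \<in> tangent_space M p. \<forall>a b.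
            \<alpha> p (vs[i := (\<lambda>f. a * v f + b * w f)]) =
              a * \<alpha> p (vs[i := v]) + b * \<alpha> p (vs[i := w])) \<and>
         (\<forall>p. \<forall>vs \<in> tuples M k p. \<forall>i<k. \<forall>j<k. i \<noteq> j \<and> vs ! i = vs ! j \<longrightarrow> \<alpha> p vs = 0) \<and>
         (\<forall>c \<in> atlas M. \<forall>is \<in> lists {..<mdim M}. length is = k \<longrightarrow>
            C_infinity_on (mdim M) (snd c ` fst c)
              (\<lambda>x. let p = chart_inv c x in \<alpha> p (map (\<lambda>i. coord_vec M c i p) is)))}"

definition pullback ::
    "'a mfd \<Rightarrow> 'b mfd \<Rightarrow> ('a \<Rightarrow> 'b) \<Rightarrow> nat \<Rightarrow> 'b dform \<Rightarrow> 'a dform" where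
  "pullback M N F k \<alpha> p vs =
     (if vs \<in> tuples M k p then \<alpha> (F p) (map (pushforward M N F p) vs) else 0)"

text \<open>
  The vector field on the domain of the chart \<open>c\<close> whose coefficients with respect to the coordinate
  vectors of \<open>c\<close> are constant and whose value at \<open>p\<close> is \<open>v\<close>.
\<close>

definition const_field :: "'a mfd \<Rightarrow> 'a chart \<Rightarrow> 'a tvec \<Rightarrow> 'a \<Rightarrow> 'a tvec" where
  "const_field M c v q = (\<lambda>f. \<Sum>l<mdim M. v (\<lambda>x. snd c x l) * coord_vec M c l q f)"

definition chart_at :: "'a mfd \<Rightarrow> 'a \<Rightarrow> 'a chart" where
  "chart_at M p = (SOME c. c \<in> atlas M \<and> p \<in> fst c)"

text \<open>
  The usual coordinate formula for the exterior derivative of a k-form. Equivalently, it is the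
  invariant formula in terms of vector fields, evaluated on constant coefficient fields: these
  commute, so no bracket terms appear. The value does not depend on the chart chosen at \<open>p\<close>.
\<close>

definition ext_deriv :: "'a mfd \<Rightarrow> nat \<Rightarrow> 'a dform \<Rightarrow> 'a dform" where
  "ext_deriv M k \<alpha> p vs =
     (if vs \<in> tuples M (Suc k) p
      then \<Sum>j\<le>k. (-1) ^ j *
             (vs ! j) (\<lambda>q. \<alpha> q (map (\<lambda>v. const_field M (chart_at M p) v q)
                                  (take j vs @ drop (Suc j) vs)))
      else 0)"


section \<open>Smooth singular chains and integration\<close>

text \<open>
  A singular simplex is smooth if near each point of the (closed) standard simplex it extends to a
  smooth map on an open subset of the ambient Euclidean space.
\<close>

definition smooth_simplex :: "nat \<Rightarrow> 'a mfd \<Rightarrow> ((nat \<Rightarrow> real) \<Rightarrow> 'a) \<Rightarrow> bool" where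
  "smooth_simplex k P \<sigma> \<longleftrightarrow>
     singular_simplex k (mtop P) \<sigma> \<and>
     (\<forall>x \<in> standard_simplex k. \<exists>W s.
        openin (Euclidean_space (Suc k)) W \<and> x \<in> W \<and> smooth_map (euclid_mfd (Suc k) W) P s \<and>
        (\<forall>y \<in> W \<inter> standard_simplex k. s y = \<sigma> y))"

definition smooth_chains :: "nat \<Rightarrow> 'a mfd \<Rightarrow> 'a chain set" where
  "smooth_chains k P = {c. \<forall>\<sigma> \<in> Poly_Mapping.keys c. smooth_simplex k P \<sigma>}"

text \<open>
  The standard k-simplex is parametrised by points of k-dimensional space as the affine image of the
  corner simplex, sending 0 to the vertex 0 and the i-th unit vector to the vertex i+1. The corner
  simplex carries the standard orientation. Only its interior is needed, the boundary being a null
  set.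
\<close>

definition corner_simplex :: "nat \<Rightarrow> (nat \<Rightarrow> real) set" where
  "corner_simplex k = {t. (\<forall>i<k. 0 < t i) \<and> (\<forall>i\<ge>k. t i = 0) \<and> (\<Sum>i<k. t i) < 1}"

definition simplex_param :: "nat \<Rightarrow> (nat \<Rightarrow> real) \<Rightarrow> nat \<Rightarrow> real" where
  "simplex_param k t j = (case j of 0 \<Rightarrow> 1 - (\<Sum>i<k. t i) | Suc i \<Rightarrow> t i)"

text \<open>
  Points of the product measure are undefined from index k on, points of \<open>Euclidean_space k\<close> are 0
  there.
\<close>

definition euclid_integral :: "nat \<Rightarrow> (nat \<Rightarrow> real) set \<Rightarrow> ((nat \<Rightarrow> real) \<Rightarrow> real) \<Rightarrow> real" where
  "euclid_integral k A f =
     (\<integral>x. (let t = (\<lambda>i. if i < k then x i else 0) in indicator A t * f t)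
        \<partial>(Pi\<^sub>M {..<k} (\<lambda>_. lborel)))"

definition simplex_integral ::
    "'a mfd \<Rightarrow> nat \<Rightarrow> 'a dform \<Rightarrow> ((nat \<Rightarrow> real) \<Rightarrow> 'a) \<Rightarrow> real" where
  "simplex_integral P k \<alpha> \<sigma> =
     (let D = corner_simplex k; E = euclid_mfd k D in
      euclid_integral k D
        (\<lambda>t. pullback E P (\<sigma> \<circ> simplex_param k) k \<alpha> t
               (map (\<lambda>i. coord_vec E (D, id) i t) [0..<k])))"

definition chain_integral :: "'a mfd \<Rightarrow> nat \<Rightarrow> 'a dform \<Rightarrow> 'a chain \<Rightarrow> real" where
  "chain_integral P k \<alpha> c =
     (\<Sum>\<sigma> \<in> Poly_Mapping.keys c.
        of_int (Poly_Mapping.lookup c \<sigma>) * simplex_integral P k \<alpha> \<sigma>)"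


section \<open>Relative forms, relative cycles and the level group\<close>

text \<open>Forms and chains of degree -1 are 0.\<close>

definition rel_forms ::
    "'a mfd \<Rightarrow> 'b mfd \<Rightarrow> nat \<Rightarrow> ('b dform \<times> 'a dform) set" where
  "rel_forms M N k =
     diff_forms N k \<times> (if k = 0 then {\<lambda>p vs. 0} else diff_forms M (k - 1))"

definition rel_deriv ::
    "'a mfd \<Rightarrow> 'b mfd \<Rightarrow> ('a \<Rightarrow> 'b) \<Rightarrow> nat \<Rightarrow> 'b dform \<times> 'a dform \<Rightarrow> 'b dform \<times> 'a dform" where
  "rel_deriv M N F k = (\<lambda>(\<alpha>, \<beta>).
     (ext_deriv N k \<alpha>, \<lambda>p vs. pullback M N F k \<alpha> p vs - ext_deriv M (k - 1) \<beta> p vs))"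

definition rel_closed ::
    "'a mfd \<Rightarrow> 'b mfd \<Rightarrow> ('a \<Rightarrow> 'b) \<Rightarrow> nat \<Rightarrow> 'b dform \<times> 'a dform \<Rightarrow> bool" where
  "rel_closed M N F k \<omega> \<longleftrightarrow> rel_deriv M N F k \<omega> = (\<lambda>p vs. 0, \<lambda>p vs. 0)"

definition rel_scale :: "real \<Rightarrow> 'b dform \<times> 'a dform \<Rightarrow> 'b dform \<times> 'a dform" where
  "rel_scale r = (\<lambda>(\<alpha>, \<beta>). (\<lambda>p vs. r * \<alpha> p vs, \<lambda>p vs. r * \<beta> p vs))"

definition rel_chains :: "'a mfd \<Rightarrow> 'b mfd \<Rightarrow> nat \<Rightarrow> ('b chain \<times> 'a chain) set" where
  "rel_chains M N k = smooth_chains k N \<times> (if k = 0 then {0} else smooth_chains (k - 1) M)"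

definition rel_cycles ::
    "'a mfd \<Rightarrow> 'b mfd \<Rightarrow> ('a \<Rightarrow> 'b) \<Rightarrow> nat \<Rightarrow> ('b chain \<times> 'a chain) set" where
  "rel_cycles M N F k =
     {(S, T) \<in> rel_chains M N k.
        chain_boundary k S = chain_map (k - 1) F T \<and> chain_boundary (k - 1) T = 0}"

definition rel_pairing ::
    "'a mfd \<Rightarrow> 'b mfd \<Rightarrow> nat \<Rightarrow> 'b dform \<times> 'a dform \<Rightarrow> 'b chain \<times> 'a chain \<Rightarrow> real" where
  "rel_pairing M N k = (\<lambda>(\<alpha>, \<beta>) (S, T). chain_integral N k \<alpha> S - chain_integral M (k - 1) \<beta> T)"

definition period_group ::
    "'a mfd \<Rightarrow> 'b mfd \<Rightarrow> ('a \<Rightarrow> 'b) \<Rightarrow> nat \<Rightarrow> 'b dform \<times> 'a dform \<Rightarrow> real set" where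
  "period_group M N F k \<omega> = rel_pairing M N k \<omega> ` rel_cycles M N F k"

definition rel_integral ::
    "'a mfd \<Rightarrow> 'b mfd \<Rightarrow> ('a \<Rightarrow> 'b) \<Rightarrow> nat \<Rightarrow> 'b dform \<times> 'a dform \<Rightarrow> bool" where
  "rel_integral M N F k \<omega> \<longleftrightarrow> period_group M N F k \<omega> \<subseteq> \<int>"

definition level_group ::
    "'a mfd \<Rightarrow> 'b mfd \<Rightarrow> ('a \<Rightarrow> 'b) \<Rightarrow> nat \<Rightarrow> 'b dform \<times> 'a dform \<Rightarrow> int set" where
  "level_group M N F k \<omega> = {l. rel_integral M N F k (rel_scale (of_int l) \<omega>)}"

end

theory Submission
  imports Defs "HOL-Computational_Algebra.Group_Closure"
begin

text \<open>
  For a fixed relative cycle \<open>c\<close> the pairing \<open>\<langle>l\<varpi>, c\<rangle>\<close> equals \<open>l \<cdot> \<langle>\<varpi>, c\<rangle>\<close>, because integration of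
  forms over simplices is homogeneous (lemma \<open>rel_pairing_scale\<close>). Hence \<open>l\<close> lies in the level
  group exactly when \<open>l\<close> times each period of \<open>\<varpi>\<close> is an integer. For a single real number \<open>x\<close> the
  integers \<open>l\<close> with \<open>l \<cdot> x \<in> \<int>\<close> form a subgroup, since \<open>\<int>\<close> is one, and the level group is the
  intersection of these subgroups over all periods \<open>x\<close>. Finally, every subgroup of the integers
  consists of the multiples of the gcd of its elements, and a nonnegative generator is
  determined by its set of multiples (lemma \<open>integer_subgroup_ex1_generator\<close>).
\<close>

text \<open>
  The Bochner integral of a non-integrable function is 0, hence it commutes with multiplication by
  a real number for all functions, integrable or not.
\<close>

lemma simplex_integral_scale:
  "simplex_integral P k (\<lambda>p vs. r * \<alpha> p vs) \<sigma> = r * simplex_integral P k \<alpha> \<sigma>"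
proof -
  have "pullback E P f k (\<lambda>p vs. r * \<alpha> p vs) t vs = r * pullback E P f k \<alpha> t vs"
    for E and f :: "(nat \<Rightarrow> real) \<Rightarrow> 'a" and t vs
    by (simp add: pullback_def)
  then show ?thesis
    by (simp add: simplex_integral_def euclid_integral_def Let_def mult.left_commute [of _ r])
qed

lemma chain_integral_scale:
  "chain_integral P k (\<lambda>p vs. r * \<alpha> p vs) c = r * chain_integral P k \<alpha> c"
  by (simp add: chain_integral_def simplex_integral_scale sum_distrib_left mult.left_commute)

lemma rel_pairing_scale:
  "rel_pairing M N k (rel_scale r \<omega>) c = r * rel_pairing M N k \<omega> c"
  by (simp add: rel_pairing_def rel_scale_def chain_integral_scale right_diff_distrib
      split: prod.splits)

lemma mem_level_group_iff:
  "l \<in> level_group M N F k \<omega> \<longleftrightarrow> (\<forall>x \<in> period_group M N F k \<omega>. of_int l * x \<in> \<int>)"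
  by (auto simp: level_group_def rel_integral_def period_group_def rel_pairing_scale)

lemma subgroup_level_group: "subgroup (level_group M N F k \<omega>) integer_group"
proof (rule group.subgroupI [OF group_integer_group])
  have "0 \<in> level_group M N F k \<omega>"
    by (simp add: mem_level_group_iff)
  then show "level_group M N F k \<omega> \<noteq> {}"
    by blast
qed (auto simp: mem_level_group_iff distrib_right)

text \<open>A subgroup is its own group closure, and Bezout's identity puts the gcd into the closure.\<close>

lemma integer_subgroup_eq_multiples_Gcd:
  assumes "subgroup H integer_group"
  shows "H = range (times (Gcd H))"
proof -
  have "group_closure H \<subseteq> H"
  proof
    fix s assume "s \<in> group_closure H"
    then show "s \<in> H"
    proof (induction rule: group_closure.induct)
      case (base s)
      then show ?case
        using subgroup.one_closed [OF assms] by auto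
    next
      case (diff s t)
      then show ?case
        using subgroup.m_closed [OF assms, of s "- t"] subgroup.m_inv_closed [OF assms, of t]
        by simp
    qed
  qed
  moreover have "H \<subseteq> group_closure H"
    by (auto intro: group_closure.base)
  ultimately show ?thesis
    by (simp add: group_closure_eq [symmetric])
qed

text \<open>Two generators divide each other, so they agree once both are nonnegative.\<close>

lemma integer_subgroup_ex1_generator:
  assumes "subgroup H integer_group"
  shows "\<exists>!k::int. k \<ge> 0 \<and> H = {k * z |z. True}"
proof (rule ex1I [of _ "Gcd H"])
  have "H = {Gcd H * z |z. True}"
    using integer_subgroup_eq_multiples_Gcd [OF assms] by blast
  then show "Gcd H \<ge> 0 \<and> H = {Gcd H * z |z. True}"
    by (intro conjI Gcd_int_greater_eq_0)
next
  fix k :: int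
  assume k: "k \<ge> 0 \<and> H = {k * z |z. True}"
  then have mem: "x \<in> H \<longleftrightarrow> k dvd x" for x
    by (auto simp: dvd_def)
  have "Gcd H * 1 \<in> H"
    using integer_subgroup_eq_multiples_Gcd [OF assms] by blast
  then have "k dvd Gcd H"
    by (simp add: mem)
  moreover have "Gcd H dvd k"
    by (rule Gcd_dvd) (simp add: mem)
  ultimately show "k = Gcd H"
    using k Gcd_int_greater_eq_0 zdvd_antisym_nonneg by blast
qed

theorem proposition3p13:
  fixes M :: "'a mfd" and N :: "'b mfd" and F :: "'a \<Rightarrow> 'b" and n :: nat
    and \<omega> :: "'b dform \<times> 'a dform"
  assumes "n \<ge> 1"
    and "smooth_manifold M" and "smooth_manifold N" and "smooth_map M N F"
    and "\<omega> \<in> rel_forms M N (n + 1)" and "rel_closed M N F (n + 1) \<omega>"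
  shows "subgroup (level_group M N F (n + 1) \<omega>) integer_group \<and>
    (\<exists>!k\<^sub>0::int. k\<^sub>0 \<ge> 0 \<and> level_group M N F (n + 1) \<omega> = {k\<^sub>0 * z |z. True})"
  using subgroup_level_group integer_subgroup_ex1_generator by blast

end
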